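(* Let $0<\alpha\le1$ and $\lambda>\mu>0$. The Adomian series components $\tilde p_k^\alpha(n,t)$, $n,k\ge0$, $t\ge0$, of the state probabilities of the linear fractional birth-death process are given by $$\tilde p_k^\alpha(n,t)=\begin{cases}0,& n=k=0\ \text{or}\ n-k\ge2,\\[1mm] (-1)^k(\lambda-\mu)^k\displaystyle\sum_{l=0}^\infty\Big(\frac{\mu}{\lambda}\Big)^{l+1}\big(l^k-(l+1)^k\big)\frac{t^{k\alpha}}{\Gamma(\alpha k+1)},& n=0,\ k\ge1,\\[2mm] (-1)^k\dfrac{(\lambda-\mu)^{k+2}}{\lambda^2}\displaystyle\sum_{l=0}^\infty\Big(\frac{\mu}{\lambda}\Big)^l\binom{n+l}{l}\sum_{r=0}^{n-1}(-1)^r\binom{n-1}{r}(r+l+1)^k\frac{t^{k\alpha}}{\Gamma(\alpha k+1)},& n\ge1,\ n-k\le1.\end{cases}$$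
   Context: The linear fractional birth-death process has birth rates $\lambda_n=n\lambda$ and death rates $\mu_n=n\mu$, $n\ge0$, and starts from one individual. With $I_t^\alpha g(t)=\frac{1}{\Gamma(\alpha)}\int_0^t (t-s)^{\alpha-1}g(s)\,\mathrm{d}s$ (Riemann–Liouville fractional integral), the Adomian series components of its state probabilities are defined recursively by $\tilde p_0^\alpha(1,t)=1$, $\tilde p_0^\alpha(n,t)=0$ for $n\ne1$, and for $k\ge1$, $n\ge0$, $$\tilde p_k^\alpha(n,t)=I_t^\alpha\big(-n(\lambda+\mu)\tilde p_{k-1}^\alpha(n,t)+(n-1)\lambda\,\tilde p_{k-1}^\alpha(n-1,t)+(n+1)\mu\,\tilde p_{k-1}^\alpha(n+1,t)\big),$$ with $\tilde p_k^\alpha(-1,t)=0$. *)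

theory Defs
  imports "HOL-Analysis.Analysis"
begin

definition RL_integral :: "real \<Rightarrow> (real \<Rightarrow> real) \<Rightarrow> real \<Rightarrow> real" where
  "RL_integral \<alpha> g t =
     1 / Gamma \<alpha> * (LINT s:{0..t}|lborel. (t - s) powr (\<alpha> - 1) * g s)"

text \<open>
  The library has \<open>0 powr 0 = 0\<close>; here the usual convention \<open>0\<^sup>0 = 1\<close> is needed, since
  the component of order \<open>0\<close> in state \<open>1\<close> is \<open>1\<close> at \<open>t = 0\<close> as well.
\<close>
definition rpow :: "real \<Rightarrow> real \<Rightarrow> real" where
  "rpow x a = (if a = 0 then 1 else x powr a)"

text \<open>
  \<open>adomian \<alpha> lam mu k n t\<close> is the component of order \<open>k\<close> for state \<open>n\<close> at time \<open>t\<close>, with birth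
  rates \<open>n * lam\<close>, death rates \<open>n * mu\<close> and one individual at time \<open>0\<close>. The conditional
  encodes that components for state \<open>-1\<close> vanish.
\<close>
primrec adomian :: "real \<Rightarrow> real \<Rightarrow> real \<Rightarrow> nat \<Rightarrow> nat \<Rightarrow> real \<Rightarrow> real" where
  "adomian \<alpha> lam mu 0 n t = (if n = 1 then 1 else 0)"
| "adomian \<alpha> lam mu (Suc k) n t =
     RL_integral \<alpha> (\<lambda>s. - (real n * (lam + mu) * adomian \<alpha> lam mu k n s)
       + (if n = 0 then 0 else (real n - 1) * lam * adomian \<alpha> lam mu k (n - 1) s)
       + (real n + 1) * mu * adomian \<alpha> lam mu k (n + 1) s) t"

end

theory Submission
  imports Defs
begin

text \<open>
  Take \<open>\<alpha> = 1\<close> first. The classical state probabilities are known in closed form, and each of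
  them depends on \<open>t\<close> only through \<open>x = exp (- (lam - mu) * t)\<close>: with \<open>q = mu / lam\<close>,
  \<open>p(0,t) = q (1 - x) / (1 - q x)\<close> and
  \<open>p(n,t) = (1 - q)\<^sup>2 x (1 - x)\<^sup>n\<^sup>-\<^sup>1 / (1 - q x)\<^sup>n\<^sup>+\<^sup>1\<close> for \<open>n \<ge> 1\<close>.
  Let \<open>G\<^sub>n\<close> be this function of \<open>x\<close>. Since \<open>q < 1\<close>, its power series has a radius of
  convergence above \<open>1\<close>, and expanding \<open>x\<^sup>m = exp (- m (lam - mu) t)\<close> in powers of \<open>t\<close> shows that
  the coefficient of \<open>t\<^sup>k / k!\<close> is \<open>(- (lam - mu))\<^sup>k\<close> times the \<open>k\<close>-th moment
  \<open>\<Sum>m. [x\<^sup>m] G\<^sub>n * m\<^sup>k\<close>. For general \<open>\<alpha>\<close> the recursion for the coefficients is unchanged, because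
  fractional integration sends \<open>s\<^sup>b / \<Gamma>(b + 1)\<close> to \<open>t\<^sup>b\<^sup>+\<^sup>\<alpha> / \<Gamma>(b + \<alpha> + 1)\<close>
  (\<open>RL_integral_rpow\<close>); only the powers of \<open>t\<close> change.

  The recursion for these coefficients can be checked without the time variable. Under the substitution, \<open>d/dt\<close> becomes
  \<open>- (lam - mu) x d/dx\<close>, so the Kolmogorov forward equations are identities between the formal power
  series \<open>G\<^sub>n\<close> (\<open>state_fps\<close>, \<open>forward_equation_state_fps\<close>). The operator \<open>x d/dx\<close> raises the order of a moment by
  one, so taking \<open>k\<close>-th moments turns these identities into exactly the Adomian recursion, while
  moments of order \<open>0\<close> are values at \<open>x = 1\<close>, that is at \<open>t = 0\<close>, and give the initial condition
  (\<open>adomian_eq_moment\<close>). It remains to write out the moments: expand \<open>(1 - x)\<^sup>n\<^sup>-\<^sup>1\<close> by the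
  binomial theorem and \<open>(1 - q x)\<^sup>-\<^sup>n\<^sup>-\<^sup>1\<close> by the negative binomial series.
\<close>

section \<open>Fractional integrals of powers\<close>

lemma RL_integral_cong:
  assumes "\<And>s. 0 \<le> s \<Longrightarrow> f s = g s"
  shows "RL_integral \<alpha> f t = RL_integral \<alpha> g t"
  unfolding RL_integral_def set_lebesgue_integral_def
  by (rule arg_cong[where f = "\<lambda>x. 1 / Gamma \<alpha> * x"], rule Bochner_Integration.integral_cong)
     (auto simp: indicator_def assms)

lemma RL_integral_cmult: "RL_integral \<alpha> (\<lambda>s. c * f s) t = c * RL_integral \<alpha> f t"
proof -
  have "(t - s) powr (\<alpha> - 1) * (c * f s) = c * ((t - s) powr (\<alpha> - 1) * f s)" for s
    by simp
  then show ?thesis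
    unfolding RL_integral_def by (simp only: set_integral_mult_right mult.left_commute)
qed

text \<open>
  The substitution \<open>s = t x\<close> reduces the interval to \<open>{0..1}\<close>, where the integral is Euler's Beta integral.
\<close>

lemma has_integral_Beta_Icc:
  fixes a b t :: real
  assumes "0 < a" "0 < b" "0 < t"
  shows "((\<lambda>s. (t - s) powr (a - 1) * s powr (b - 1)) has_integral
           t powr (a + b - 1) * Beta a b) {0..t}"
proof -
  have "((\<lambda>x. x powr (b - 1) * (1 - x) powr (a - 1)) has_integral Beta b a) (cbox 0 1)"
    using has_integral_Beta_real[of b a] assms by simp
  from has_integral_affinity'[OF this, of "1 / t" 0]
  have "((\<lambda>s. (s / t) powr (b - 1) * (1 - s / t) powr (a - 1)) has_integral t * Beta a b) {0..t}"
    using assms by (simp add: Beta_commute divide_simps)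
  from has_integral_mult_right[OF this, of "t powr (a + b - 2)"]
  have "((\<lambda>s. t powr (a + b - 2) * ((s / t) powr (b - 1) * (1 - s / t) powr (a - 1)))
          has_integral t powr (a + b - 1) * Beta a b) {0..t}"
    using assms powr_add[of t "a + b - 2" 1] by (simp add: algebra_simps)
  moreover have "t powr (a + b - 2) * ((s / t) powr (b - 1) * (1 - s / t) powr (a - 1))
      = (t - s) powr (a - 1) * s powr (b - 1)" if "s \<in> {0..t}" for s
  proof -
    have "1 - s / t = (t - s) / t" using assms by (simp add: field_simps)
    moreover have "t powr (a + b - 2) = t powr (b - 1) * t powr (a - 1)"
      by (simp add: add.commute flip: powr_add)
    ultimately show ?thesis using assms that by (simp add: powr_divide)
  qed
  ultimately show ?thesis
    by (rule has_integral_eq[rotated]) auto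
qed

text \<open>
  A nonnegative Borel function is Lebesgue integrable as soon as its Henstock--Kurzweil integral
  exists. The Beta integral, whose integrand may be unbounded, enters in the latter form.
\<close>

lemma set_lborel_integral_eqI:
  fixes f :: "real \<Rightarrow> real"
  assumes meas: "f \<in> borel_measurable borel" and S: "S \<in> sets borel"
    and nonneg: "\<And>x. x \<in> S \<Longrightarrow> 0 \<le> f x"
    and int: "(f has_integral I) S"
  shows "(LINT x:S|lborel. f x) = I"
proof -
  let ?g = "\<lambda>x. indicator S x * f x"
  have g: "?g \<in> borel_measurable borel" using meas S by simp
  have g0: "0 \<le> ?g x" for x using nonneg by (simp add: indicator_def)
  have "(\<lambda>x. if x \<in> S then f x else 0) = ?g" by (auto simp: indicator_def)
  then have "(?g has_integral I) UNIV"
    using int has_integral_restrict_UNIV[of S f I] by simp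
  from nn_integral_has_integral_lborel[OF g g0 this]
  have "integral\<^sup>N lborel ?g = ennreal I" .
  moreover have "0 \<le> I" using int nonneg by (rule has_integral_nonneg)
  ultimately have "integral\<^sup>L lborel ?g = I"
    using g g0 by (subst integral_eq_nn_integral) auto
  then show ?thesis by (simp add: set_lebesgue_integral_def)
qed

lemma RL_integral_rpow:
  fixes \<alpha> b t :: real
  assumes "0 < \<alpha>" "0 \<le> b" "0 \<le> t"
  shows "RL_integral \<alpha> (\<lambda>s. rpow s b / Gamma (b + 1)) t = rpow t (b + \<alpha>) / Gamma (b + \<alpha> + 1)"
proof -
  have gpos: "Gamma \<alpha> > 0" "Gamma (b + 1) > 0"
    using assms by (auto intro!: Gamma_real_pos)
  show ?thesis
  proof (cases "t = 0")
    case True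
    have "(LINT s:{0..0}|lborel. (0 - s) powr (\<alpha> - 1) * (rpow s b / Gamma (b + 1))) = (0::real)"
      by (intro set_lborel_integral_eqI)
         (use assms gpos in \<open>auto simp: rpow_def\<close>)
    then have "RL_integral \<alpha> (\<lambda>s. rpow s b / Gamma (b + 1)) t = 0"
      unfolding RL_integral_def True by (simp only: mult_zero_right)
    with True assms show ?thesis by (simp add: rpow_def)
  next
    case False
    with assms have t: "0 < t" by simp
    let ?f = "\<lambda>s. (t - s) powr (\<alpha> - 1) * (rpow s b / Gamma (b + 1))"
    have "((\<lambda>s. (t - s) powr (\<alpha> - 1) * s powr b / Gamma (b + 1)) has_integral
            t powr (b + \<alpha>) * Beta \<alpha> (b + 1) / Gamma (b + 1)) {0..t}"
      using has_integral_divide[OF has_integral_Beta_Icc[of \<alpha> "b + 1" t]] assms t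
      by (simp add: add_ac)
    \<comment> \<open>\<open>rpow s 0\<close> and \<open>s powr 0\<close> differ at \<open>s = 0\<close>.\<close>
    then have "(?f has_integral t powr (b + \<alpha>) * Beta \<alpha> (b + 1) / Gamma (b + 1)) {0..t}"
      by (rule has_integral_spike_finite[rotated 2, where S = "{0}"]) (auto simp: rpow_def)
    then have "(LINT s:{0..t}|lborel. ?f s) = t powr (b + \<alpha>) * Beta \<alpha> (b + 1) / Gamma (b + 1)"
      by (intro set_lborel_integral_eqI)
         (use assms gpos in \<open>auto simp: rpow_def\<close>)
    moreover have "Gamma \<alpha> \<noteq> 0" "Gamma (b + 1) \<noteq> 0"
      using gpos by auto
    ultimately show ?thesis
      using assms by (simp add: RL_integral_def rpow_def Beta_def add_ac)
  qed
qed

section \<open>Moments of power series\<close>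

lemma fps_conv_radius_prod_gt:
  fixes f g :: "real fps"
  shows "fps_conv_radius f > r \<Longrightarrow> fps_conv_radius g > r \<Longrightarrow> fps_conv_radius (f * g) > r"
  using less_le_trans[OF _ fps_conv_radius_mult[of f g], of r] by simp

lemma fps_conv_radius_add_gt:
  fixes f g :: "real fps"
  shows "fps_conv_radius f > r \<Longrightarrow> fps_conv_radius g > r \<Longrightarrow> fps_conv_radius (f + g) > r"
  using less_le_trans[OF _ fps_conv_radius_add[of f g], of r] by simp

lemma fps_conv_radius_XD_gt:
  fixes f :: "real fps"
  assumes "fps_conv_radius f > 1"
  shows "fps_conv_radius (fps_XD f) > 1"
  using less_le_trans[OF assms fps_conv_radius_deriv]
  by (simp add: fps_XD_def fps_conv_radius_prod_gt)

text \<open>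
  This is the value at \<open>1\<close> of \<open>f\<close> after \<open>k\<close> applications of \<open>x d/dx\<close>. It is meaningful if the
  radius of convergence of \<open>f\<close> exceeds \<open>1\<close>. The convention \<open>0 ^ 0 = 1\<close> makes the constant term count
  for \<open>k = 0\<close>.
\<close>

definition moment :: "nat \<Rightarrow> real fps \<Rightarrow> real" where
  "moment k f = (\<Sum>m. fps_nth f m * real m ^ k)"

text \<open>
  The operator \<open>x d/dx\<close> multiplies the \<open>m\<close>-th coefficient by \<open>m\<close> and does not shrink the disc of
  convergence, so the factors \<open>m ^ k\<close> do no harm.
\<close>

lemma moment_sums:
  assumes "fps_conv_radius f > 1"
  shows "(\<lambda>m. fps_nth f m * real m ^ k) sums moment k f"
proof -
  have "fps_conv_radius ((fps_XD ^^ k) f) > 1"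
    by (induction k) (auto simp: assms intro: fps_conv_radius_XD_gt)
  then have "summable (\<lambda>m. fps_nth f m * real m ^ k)"
    using summable_fps[of 1 "(fps_XD ^^ k) f"]
    by (simp add: one_ereal_def fps_mult_fps_XD_shift mult.commute)
  then show ?thesis by (simp add: moment_def summable_sums)
qed

lemma moment_0: "moment 0 f = eval_fps f 1"
  by (simp add: moment_def eval_fps_def)

lemma moment_XD: "moment k (fps_XD f) = moment (Suc k) f"
  by (simp add: moment_def mult_ac)

lemma moment_cmult: "fps_conv_radius f > 1 \<Longrightarrow> moment k (fps_const c * f) = c * moment k f"
  using sums_mult[OF moment_sums, of f c k] by (simp add: moment_def sums_iff mult_ac)

lemma moment_add:
  "fps_conv_radius f > 1 \<Longrightarrow> fps_conv_radius g > 1 \<Longrightarrow> moment k (f + g) = moment k f + moment k g"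
  using sums_add[OF moment_sums moment_sums, of f g k k] by (simp add: moment_def sums_iff algebra_simps)

lemma moment_power_X_mult_sums:
  assumes "fps_conv_radius f > 1"
  shows "(\<lambda>l. fps_nth f l * (real l + real j) ^ k) sums moment k (fps_X ^ j * f)"
proof -
  have "fps_conv_radius (fps_X ^ j * f) > 1"
    using less_le_trans[OF _ fps_conv_radius_mult[of "fps_X ^ j" f]] assms by simp
  from sums_split_initial_segment[OF moment_sums[OF this, of k], of j]
  show ?thesis by (simp add: fps_X_power_mult_nth)
qed

section \<open>The state probabilities as power series\<close>

definition geometric_fps :: "real \<Rightarrow> real fps" where
  "geometric_fps q = inverse (1 - fps_const q * fps_X)"

lemma geometric_fps_times: "(1 - fps_const q * fps_X) * geometric_fps q = 1"
  unfolding geometric_fps_def by (rule inverse_mult_eq_1') simp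

lemma deriv_geometric_fps:
  "fps_deriv (geometric_fps q) = fps_const q * geometric_fps q ^ 2"
  unfolding geometric_fps_def by (subst fps_inverse_deriv) simp_all

lemma nth_geometric_fps_power:
  "fps_nth (geometric_fps q ^ Suc n) l = q ^ l * real ((n + l) choose l)"
  unfolding geometric_fps_def
  by (subst fps_inverse_power[symmetric], subst one_minus_const_fps_X_neg_power')
     (simp_all add: mult.commute)

lemma fps_conv_radius_geometric_fps_power:
  assumes "0 < q" "q < 1"
  shows "fps_conv_radius (geometric_fps q ^ n) > 1"
proof -
  obtain z where z: "1 < z" "z < 1 / q"
    using dense[of 1 "1 / q"] assms by (auto simp: field_simps)
  have "summable (\<lambda>l. (q * z) ^ l)"
    using assms z by (intro summable_geometric) (auto simp: field_simps)
  then have "ereal (norm z) \<le> fps_conv_radius (geometric_fps q)"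
    unfolding fps_conv_radius_def
    by (intro conv_radius_geI) (use nth_geometric_fps_power[of q 0] in \<open>simp add: power_mult_distrib\<close>)
  also have "\<dots> \<le> fps_conv_radius (geometric_fps q ^ n)" by (rule fps_conv_radius_power)
  finally show ?thesis using z by (auto elim!: less_le_trans[rotated])
qed

text \<open>
  The classical probability of state \<open>n\<close> at time \<open>t\<close>, for birth rate \<open>1\<close> and death rate \<open>q\<close>, as a
  power series in \<open>x = exp (- (1 - q) * t)\<close>.
\<close>

definition state_fps :: "real \<Rightarrow> nat \<Rightarrow> real fps" where
  "state_fps q n =
     (if n = 0 then fps_const q * ((1 - fps_X) * geometric_fps q)
      else fps_const ((1 - q)\<^sup>2) * (fps_X * (1 - fps_X) ^ (n - 1) * geometric_fps q ^ (n + 1)))"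

lemma fps_conv_radius_1_minus_X_power: "fps_conv_radius ((1 - fps_X :: real fps) ^ n) = \<infinity>"
proof -
  have "fps_conv_radius (1 - fps_X :: real fps) = \<infinity>"
    using fps_conv_radius_diff[of "1 :: real fps" fps_X] by simp
  then show ?thesis using fps_conv_radius_power[of "1 - fps_X :: real fps" n] by simp
qed

lemma fps_conv_radius_state_fps:
  assumes "0 < q" "q < 1"
  shows "fps_conv_radius (state_fps q n) > 1"
  unfolding state_fps_def
  using fps_conv_radius_geometric_fps_power[OF assms, of 1] fps_conv_radius_1_minus_X_power[of 1]
  by (auto intro!: fps_conv_radius_prod_gt fps_conv_radius_geometric_fps_power assms
           simp: fps_conv_radius_1_minus_X_power simp del: power_Suc)

text \<open>
  Evaluation at \<open>x = 1\<close> corresponds to time \<open>0\<close>: the factors \<open>1 - x\<close> vanish there, and for \<open>n = 1\<close>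
  what is left is \<open>(1 - q)\<^sup>2 / (1 - q)\<^sup>2\<close>.
\<close>

lemma moment_0_state_fps:
  assumes "0 < q" "q < 1"
  shows "moment 0 (state_fps q n) = (if n = 1 then 1 else 0)"
proof -
  let ?P = "\<lambda>n. (1 - fps_X :: real fps) ^ n" and ?G = "\<lambda>n. geometric_fps q ^ n"
  note rad = fps_conv_radius_geometric_fps_power[OF assms] fps_conv_radius_1_minus_X_power
  have rad1: "fps_conv_radius (1 - fps_X :: real fps) = \<infinity>" "1 < fps_conv_radius (geometric_fps q)"
    using rad(1)[of 1] rad(2)[of 1] by simp_all
  have P: "eval_fps (?P n) 1 = 0 ^ n" for n
    by (subst eval_fps_power) (auto simp: rad1 eval_fps_diff)
  have "eval_fps ((1 - fps_const q * fps_X) * geometric_fps q) 1 = 1"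
    by (simp add: geometric_fps_times)
  moreover have "fps_conv_radius (1 - fps_const q * fps_X :: real fps) = \<infinity>"
    using fps_conv_radius_diff[of "1 :: real fps" "fps_const q * fps_X"]
      fps_conv_radius_mult[of "fps_const q" "fps_X"] by simp
  moreover have "eval_fps (1 - fps_const q * fps_X) 1 = 1 - q"
    using fps_conv_radius_mult[of "fps_const q" "fps_X"] by (simp add: eval_fps_diff eval_fps_mult)
  ultimately have "(1 - q) * eval_fps (geometric_fps q) 1 = 1"
    using rad1 by (subst (asm) eval_fps_mult) (auto simp: one_ereal_def)
  then have "eval_fps (geometric_fps q) 1 = 1 / (1 - q)"
    using assms by (simp add: field_simps)
  then have G: "eval_fps (?G n) 1 = (1 / (1 - q)) ^ n" for n
    using rad1 by (subst eval_fps_power) (auto simp: one_ereal_def)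
  have mult: "eval_fps (f * g) 1 = eval_fps f 1 * eval_fps g 1"
    if "1 < fps_conv_radius f" "1 < fps_conv_radius g" for f g :: "real fps"
    using that by (intro eval_fps_mult) (auto simp: one_ereal_def)
  show ?thesis
    using P[of 1] G[of 1] assms
    by (simp add: moment_0 state_fps_def mult rad rad1 P G fps_conv_radius_prod_gt
          power_divide flip: numeral_2_eq_2 del: power_Suc)
qed

text \<open>
  The Kolmogorov forward equations after the substitution \<open>x = exp (- (1 - q) * t)\<close>, under which
  \<open>d/dt\<close> is \<open>(q - 1) x d/dx\<close>. All series in the equation for state \<open>n\<close> are polynomials times powers of
  \<open>1 / (1 - q x)\<close> with exponent at most \<open>n + 2\<close>. Pulling out the highest power leaves a polynomial
  identity. The states \<open>0\<close> and \<open>1\<close> are separate cases: the former has a probability of a different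
  form, and it is a neighbour of the latter.
\<close>

lemma forward_equation_state_fps:
  "fps_const (q - 1) * fps_XD (state_fps q n) =
     fps_const (- (real n * (1 + q))) * state_fps q n
     + fps_const (if n = 0 then 0 else real n - 1) * state_fps q (n - 1)
     + fps_const ((real n + 1) * q) * state_fps q (n + 1)"
proof -
  define X :: "real fps" where "X = fps_X"
  define Q where "Q = fps_const q"
  define H where "H = geometric_fps q"
  have H: "(1 - Q * X) * H = 1" unfolding X_def Q_def H_def by (rule geometric_fps_times)
  have DH: "fps_deriv H = Q * H\<^sup>2" unfolding H_def Q_def by (rule deriv_geometric_fps)
  have DX: "fps_deriv X = 1" by (simp add: X_def)
  have S0: "state_fps q 0 = Q * ((1 - X) * H)"
    by (simp add: state_fps_def X_def Q_def H_def)
  have S: "state_fps q (Suc m) = (1 - Q)\<^sup>2 * (X * (1 - X) ^ m * H ^ (m + 2))" for m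
    by (simp add: state_fps_def X_def Q_def H_def flip: fps_const_power fps_const_sub)
  define U where "U = 1 - Q * X"
  define N where "N = fps_const (real n)"
  \<comment> \<open>The rule that brings all powers of \<open>H\<close> to the highest one.\<close>
  have U: "U * H ^ Suc j = H ^ j" for j
    using H by (simp add: U_def mult.assoc[symmetric])
  have coeffs: "fps_const (q - 1) = Q - 1" "fps_const (- (real n * (1 + q))) = - (N * (1 + Q))"
    "fps_const ((real n + 1) * q) = (N + 1) * Q" "fps_const (real n - 1) = N - 1"
    by (simp_all add: Q_def N_def flip: fps_const_add fps_const_sub fps_const_mult fps_const_neg)
  have "fps_deriv Q = 0" by (simp add: Q_def)
  note D = this DX DH
  have DH_power: "fps_deriv (H ^ j) = of_nat j * Q * H ^ Suc j" for j
    unfolding fps_deriv_power' DH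
    by (cases j) (simp_all add: power2_eq_square mult_ac del: of_nat_Suc)
  have DX_power: "fps_deriv ((1 - X) ^ j) = - (of_nat j * (1 - X) ^ (j - 1))" for j
    unfolding fps_deriv_power' by (simp add: DX)
  consider "n = 0" | "n = 1" | m where "n = m + 2"
    by (metis One_nat_def add_2_eq_Suc' not0_implies_Suc)
  then show ?thesis
  proof cases
    case 1
    have "fps_deriv (state_fps q 0) = Q * (- H + (1 - X) * (Q * H\<^sup>2))"
      unfolding S0 by (simp add: D)
    also have "- H = - (U * H\<^sup>2)" using U[of 1] by (simp add: numeral_2_eq_2)
    finally have XD: "fps_XD (state_fps q n) = X * (Q * (- (U * H\<^sup>2) + (1 - X) * (Q * H\<^sup>2)))"
      using 1 by (simp add: fps_XD_def X_def)
    have S1: "state_fps q (n + 1) = (1 - Q)\<^sup>2 * (X * H\<^sup>2)"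
      using S[of 0] 1 by (simp add: power2_eq_square)
    have "N = 0" using 1 by (simp add: N_def)
    then show ?thesis
      unfolding XD S1 coeffs U_def using 1 by (simp add: algebra_simps power2_eq_square)
  next
    case 2
    have H2: "H\<^sup>2 = U * H ^ 3" using U[of 2] by (simp add: numeral_3_eq_3)
    have S1: "state_fps q 1 = (1 - Q)\<^sup>2 * (X * H\<^sup>2)"
      using S[of 0] by (simp add: power2_eq_square)
    have "fps_deriv (state_fps q 1) = (1 - Q)\<^sup>2 * (H\<^sup>2 + X * (2 * Q * H ^ 3))"
      unfolding S1 using DH_power[of 2]
      by (simp add: D power2_eq_square algebra_simps numeral_3_eq_3)
    then have XD: "fps_XD (state_fps q n) = X * ((1 - Q)\<^sup>2 * (U * H ^ 3 + X * (2 * Q * H ^ 3)))"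
      unfolding H2 using 2 by (simp add: fps_XD_def X_def)
    have S12: "state_fps q n = (1 - Q)\<^sup>2 * (X * (U * H ^ 3))"
      "state_fps q (n + 1) = (1 - Q)\<^sup>2 * (X * (1 - X) * H ^ 3)"
      using S1[unfolded H2] S[of 1] 2 by (simp_all add: eval_nat_numeral)
    have "N = 1" using 2 by (simp add: N_def)
    then show ?thesis
      unfolding XD unfolding S12 coeffs U_def using 2 by (simp add: algebra_simps power2_eq_square)
  next
    case 3
    define Z where "Z = H ^ (m + 4)"
    define P where "P = (1 - X) ^ m"
    define M :: "real fps" where "M = of_nat m"
    have HZ: "H ^ (m + 4) = Z" "H ^ (m + 3) = U * Z" "H ^ (m + 2) = U * (U * Z)"
      using U[of "m + 3"] U[of "m + 2"]
      by (simp_all add: Z_def eval_nat_numeral del: power_Suc)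
    have PZ: "(1 - X) ^ m = P" "(1 - X) ^ (m + 1) = (1 - X) * P"
      "(1 - X) ^ (m + 2) = (1 - X) * ((1 - X) * P)"
      by (simp_all add: P_def)
    have N: "N = M + 2" using 3 by (simp add: N_def M_def fps_of_nat flip: fps_const_add)
    have S3: "state_fps q (n - 1) = (1 - Q)\<^sup>2 * (X * (1 - X) ^ m * H ^ (m + 2))"
      "state_fps q n = (1 - Q)\<^sup>2 * (X * (1 - X) ^ (m + 1) * H ^ (m + 3))"
      "state_fps q (n + 1) = (1 - Q)\<^sup>2 * (X * (1 - X) ^ (m + 2) * H ^ (m + 4))"
      using S[of m] S[of "m + 1"] S[of "m + 2"] 3
      by (simp_all add: numeral_3_eq_3 eval_nat_numeral(2) del: power_Suc)
    have "fps_deriv (state_fps q n) = (1 - Q)\<^sup>2 * fps_deriv (X * (1 - X) ^ (m + 1) * H ^ (m + 3))"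
      unfolding S3 by (simp add: D power2_eq_square[of "1 - Q"])
    also have "fps_deriv (X * (1 - X) ^ (m + 1) * H ^ (m + 3)) =
        (1 - X) ^ (m + 1) * H ^ (m + 3) - X * (of_nat (m + 1) * (1 - X) ^ m * H ^ (m + 3))
        + X * (1 - X) ^ (m + 1) * (of_nat (m + 3) * Q * H ^ (m + 4))"
      unfolding fps_deriv_mult DH_power DX_power DX
      by (simp add: eval_nat_numeral algebra_simps)
    finally have XD: "fps_XD (state_fps q n) = X * ((1 - Q)\<^sup>2 *
       ((1 - X) * P * (U * Z) - X * ((M + 1) * P * (U * Z)) + X * ((1 - X) * P) * ((M + 3) * Q * Z)))"
      unfolding HZ PZ by (simp add: fps_XD_def X_def M_def add.commute)
    have pos: "(if n = 0 then 0 else real n - 1) = real n - 1" using 3 by simp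
    show ?thesis
      unfolding XD pos coeffs N unfolding S3 HZ PZ by (simp add: U_def algebra_simps power2_eq_square)
  qed
qed

section \<open>The Adomian components\<close>

text \<open>
  One step of the recursion raises the highest occupied state by at most one, starting from state \<open>1\<close>.
\<close>

lemma adomian_eq_0:
  assumes "k + 2 \<le> n"
  shows "adomian \<alpha> lam mu k n t = 0"
  using assms
proof (induction k arbitrary: n t)
  case (Suc k)
  then have "adomian \<alpha> lam mu k m = (\<lambda>s. 0)" if "n - 1 \<le> m" for m
    using that by (intro ext) simp
  then show ?case using Suc.prems by (simp add: RL_integral_def)
qed simp

text \<open>
  One formula for all \<open>n\<close> and \<open>k\<close>, which makes the induction on \<open>k\<close> go through. In the step, the
  recursion produces the linear combination of \<open>k\<close>-th moments on the right-hand side of the forward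
  equation; its left-hand side contributes the moment of order \<open>k + 1\<close> and the factor
  \<open>lam * (q - 1) = - (lam - mu)\<close>.
\<close>

lemma adomian_eq_moment:
  assumes "0 < \<alpha>" "0 < mu" "mu < lam" "0 \<le> t"
  shows "adomian \<alpha> lam mu k n t =
    (- (lam - mu)) ^ k * moment k (state_fps (mu / lam) n)
      * (rpow t (real k * \<alpha>) / Gamma (\<alpha> * real k + 1))"
  using \<open>0 \<le> t\<close>
proof (induction k arbitrary: n t)
  case 0
  then show ?case using moment_0_state_fps[of "mu / lam" n] assms by (simp add: rpow_def)
next
  case (Suc k)
  define q where "q = mu / lam"
  have q: "0 < q" "q < 1" and lam: "0 < lam" and mu: "mu = lam * q"
    using assms by (auto simp: q_def)
  define e where "e j = moment k (state_fps q j)" for j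
  define C where "C = (- (lam - mu)) ^ k *
    (- (real n * (lam + mu)) * e n + (if n = 0 then 0 else real n - 1) * lam * e (n - 1)
      + (real n + 1) * mu * e (n + 1))"
  note rad = fps_conv_radius_state_fps[OF q]
  have rad_c: "fps_conv_radius (fps_const c * state_fps q j) > 1" for c j
    by (simp add: fps_conv_radius_prod_gt rad)
  have "(q - 1) * moment (Suc k) (state_fps q n) = moment k (fps_const (q - 1) * fps_XD (state_fps q n))"
    by (simp add: moment_cmult fps_conv_radius_XD_gt rad moment_XD)
  also have "\<dots> = - (real n * (1 + q)) * e n + (if n = 0 then 0 else real n - 1) * e (n - 1)
      + (real n + 1) * q * e (n + 1)"
    unfolding forward_equation_state_fps e_def
    by (simp only: moment_add moment_cmult rad rad_c fps_conv_radius_add_gt)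
  finally have "lam * ((q - 1) * moment (Suc k) (state_fps q n)) =
      lam * (- (real n * (1 + q)) * e n + (if n = 0 then 0 else real n - 1) * e (n - 1)
      + (real n + 1) * q * e (n + 1))"
    by simp
  then have C: "C = (- (lam - mu)) ^ Suc k * moment (Suc k) (state_fps q n)"
    unfolding C_def power_Suc2 mult.assoc
    by (intro arg_cong[where f = "(*) ((- (lam - mu)) ^ k)"]) (simp add: mu algebra_simps)
  have "adomian \<alpha> lam mu (Suc k) n t =
      RL_integral \<alpha> (\<lambda>s. C * (rpow s (real k * \<alpha>) / Gamma (real k * \<alpha> + 1))) t"
    unfolding adomian.simps
  proof (rule RL_integral_cong, goal_cases)
    case (1 s)
    define A where "A = (- (lam - mu)) ^ k"
    define p where "p = rpow s (real k * \<alpha>) / Gamma (real k * \<alpha> + 1)"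
    have IH: "adomian \<alpha> lam mu k j s = A * e j * p" for j
      using Suc.IH[OF 1] by (simp add: A_def e_def q_def p_def mult.commute[of \<alpha>])
    show ?case
      unfolding IH C_def A_def[symmetric] p_def[symmetric] by (simp add: algebra_simps)
  qed
  also have "\<dots> = C * (rpow t (real (Suc k) * \<alpha>) / Gamma (\<alpha> * real (Suc k) + 1))"
    using RL_integral_rpow[of \<alpha> "real k * \<alpha>" t] Suc.prems assms
    by (simp only: RL_integral_cmult) (simp add: algebra_simps)
  finally show ?case unfolding C q_def .
qed

text \<open>
  The series of state \<open>0\<close> is \<open>q (h - x h)\<close> with \<open>h\<close> the geometric series; multiplication by \<open>x\<close>
  shifts \<open>l ^ k\<close> to \<open>(l + 1) ^ k\<close>.
\<close>

lemma moment_state_fps_0_sums: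
  assumes "0 < q" "q < 1"
  shows "(\<lambda>l. q ^ (l + 1) * (real l ^ k - (real l + 1) ^ k)) sums moment k (state_fps q 0)"
proof -
  let ?H = "geometric_fps q"
  have rad: "fps_conv_radius ?H > 1"
    using fps_conv_radius_geometric_fps_power[OF assms, of 1] by simp
  have nth: "fps_nth ?H l = q ^ l" for l
    using nth_geometric_fps_power[of q 0 l] by simp
  have rad1: "fps_conv_radius (fps_const c * (fps_X ^ j * ?H)) > 1"
      "fps_conv_radius (fps_X ^ j * ?H) > 1" for c j
    by (auto intro!: fps_conv_radius_prod_gt rad)
  have "state_fps q 0 = fps_const q * (fps_X ^ 0 * ?H) + fps_const (- q) * (fps_X ^ 1 * ?H)"
    by (simp add: state_fps_def algebra_simps flip: fps_const_neg)
  then have moment: "moment k (state_fps q 0) =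
      q * moment k (fps_X ^ 0 * ?H) + (- q) * moment k (fps_X ^ 1 * ?H)"
    by (simp only: moment_add moment_cmult rad1)
  have eq: "q ^ (l + 1) * (real l ^ k - (real l + 1) ^ k) =
      q * (q ^ l * (real l + real 0) ^ k) + (- q) * (q ^ l * (real l + real 1) ^ k)" for l
    by (simp add: algebra_simps)
  show ?thesis
    unfolding moment eq
    using moment_power_X_mult_sums[OF rad, of 0 k] moment_power_X_mult_sums[OF rad, of 1 k]
    unfolding nth by (intro sums_add sums_mult)
qed

text \<open>
  Expanding \<open>(1 - x)\<^sup>n\<^sup>-\<^sup>1\<close> writes the series of state \<open>n\<close> as a finite combination of
  \<open>x\<^sup>r\<^sup>+\<^sup>1 (1 - q x)\<^sup>-\<^sup>n\<^sup>-\<^sup>1\<close>; the powers of \<open>x\<close> shift \<open>l ^ k\<close> to \<open>(r + l + 1) ^ k\<close>. Because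
  the sum over \<open>r\<close> is finite, the series over \<open>l\<close> may be added term by term.
\<close>

lemma moment_state_fps_pos_sums:
  assumes "0 < q" "q < 1" "1 \<le> n"
  shows "(\<lambda>l. q ^ l * real ((n + l) choose l) *
           (\<Sum>r = 0..n - 1. (-1) ^ r * real ((n - 1) choose r) * (real r + real l + 1) ^ k))
         sums (moment k (state_fps q n) / (1 - q)\<^sup>2)"
proof -
  let ?H = "geometric_fps q ^ Suc n"
  define a where "a r = (-1) ^ r * real ((n - 1) choose r)" for r
  have rad: "fps_conv_radius ?H > 1" by (rule fps_conv_radius_geometric_fps_power) fact+
  have rad1: "fps_conv_radius (fps_const c * (fps_X ^ j * ?H)) > 1"
      "fps_conv_radius (fps_X ^ j * ?H) > 1" for c j
    by (auto intro!: fps_conv_radius_prod_gt rad simp del: power_Suc)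
  have rad_sum: "fps_conv_radius (\<Sum>r\<in>A. fps_const (a r) * (fps_X ^ Suc r * ?H)) > 1"
    if "finite A" for A
    using that by (induction A) (auto intro!: fps_conv_radius_add_gt rad1 simp del: power_Suc)
  have msum: "moment k (\<Sum>r\<in>A. fps_const (a r) * (fps_X ^ Suc r * ?H)) =
      (\<Sum>r\<in>A. a r * moment k (fps_X ^ Suc r * ?H))" if "finite A" for A
    using that
    by (induction A) (simp_all add: moment_add moment_cmult rad1 rad_sum del: power_Suc,
        simp add: moment_def)
  have sign: "fps_const ((-1) ^ r) = (-1 :: real fps) ^ r" for r
    by (induction r) (simp_all flip: fps_const_neg)
  have "(1 - fps_X :: real fps) ^ (n - 1) = (\<Sum>r = 0..n - 1. fps_const (a r) * fps_X ^ r)"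
    using binomial_ring[of "- fps_X :: real fps" 1 "n - 1"]
    by (simp add: a_def sign atLeast0AtMost power_minus[of fps_X] fps_of_nat mult_ac
        flip: fps_const_mult)
  then have "state_fps q n = fps_const ((1 - q)\<^sup>2) * (\<Sum>r = 0..n - 1. fps_const (a r) * (fps_X ^ Suc r * ?H))"
    using assms by (simp add: state_fps_def sum_distrib_left sum_distrib_right mult_ac)
  then have "moment k (state_fps q n) = (1 - q)\<^sup>2 * (\<Sum>r = 0..n - 1. a r * moment k (fps_X ^ Suc r * ?H))"
    by (simp only: moment_cmult rad_sum msum finite_atLeastAtMost)
  then have eq: "moment k (state_fps q n) / (1 - q)\<^sup>2 =
      (\<Sum>r = 0..n - 1. a r * moment k (fps_X ^ Suc r * ?H))"
    using assms by simp
  have "(\<lambda>l. \<Sum>r = 0..n - 1. a r * (fps_nth ?H l * (real l + real (Suc r)) ^ k))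
      sums (\<Sum>r = 0..n - 1. a r * moment k (fps_X ^ Suc r * ?H))"
    by (intro sums_sum sums_mult moment_power_X_mult_sums rad)
  then show ?thesis
    unfolding eq nth_geometric_fps_power a_def by (simp add: sum_distrib_left mult_ac add_ac)
qed

theorem corollary4p1:
  fixes \<alpha> lam mu t :: real and n k :: nat
  assumes "0 < \<alpha>" and "\<alpha> \<le> 1" and "0 < mu" and "mu < lam" and "0 \<le> t"
  shows
   "((n = 0 \<and> k = 0 \<or> n \<ge> k + 2) \<longrightarrow> adomian \<alpha> lam mu k n t = 0)
  \<and> (n = 0 \<and> k \<ge> 1 \<longrightarrow>
      summable (\<lambda>l. (mu / lam) ^ (l + 1) * (real l ^ k - (real l + 1) ^ k)
                     * (rpow t (real k * \<alpha>) / Gamma (\<alpha> * real k + 1)))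
    \<and> adomian \<alpha> lam mu k n t =
      (-1) ^ k * (lam - mu) ^ k *
      (\<Sum>l. (mu / lam) ^ (l + 1) * (real l ^ k - (real l + 1) ^ k)
             * (rpow t (real k * \<alpha>) / Gamma (\<alpha> * real k + 1))))
  \<and> (n \<ge> 1 \<and> n \<le> k + 1 \<longrightarrow>
      summable (\<lambda>l. (mu / lam) ^ l * real ((n + l) choose l)
                     * (\<Sum>r = 0..n - 1. (-1) ^ r * real ((n - 1) choose r) * (real r + real l + 1) ^ k)
                     * (rpow t (real k * \<alpha>) / Gamma (\<alpha> * real k + 1)))
    \<and> adomian \<alpha> lam mu k n t =
      (-1) ^ k * ((lam - mu) ^ (k + 2) / lam ^ 2) *
      (\<Sum>l. (mu / lam) ^ l * real ((n + l) choose l)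
             * (\<Sum>r = 0..n - 1. (-1) ^ r * real ((n - 1) choose r) * (real r + real l + 1) ^ k)
             * (rpow t (real k * \<alpha>) / Gamma (\<alpha> * real k + 1))))"
proof -
  define q where "q = mu / lam"
  define c where "c = rpow t (real k * \<alpha>) / Gamma (\<alpha> * real k + 1)"
  have q: "0 < q" "q < 1" using assms by (auto simp: q_def)
  have adomian: "adomian \<alpha> lam mu k n t = (-1) ^ k * (lam - mu) ^ k * (moment k (state_fps q n) * c)"
    using adomian_eq_moment[of \<alpha> mu lam t k n] assms
    by (simp add: q_def c_def flip: power_mult_distrib)
  have "1 - q = (lam - mu) / lam" using assms by (simp add: q_def field_simps)
  then have coeff: "x * (lam - mu) ^ k * y =
      x * ((lam - mu) ^ (k + 2) / lam\<^sup>2) * (y / (1 - q)\<^sup>2)" for x y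
    using assms by (simp add: power_divide power_add power2_eq_square)
  show ?thesis
    unfolding q_def[symmetric] c_def[symmetric]
  proof (intro conjI impI; (elim conjE)?)
    assume "n = 0 \<and> k = 0 \<or> k + 2 \<le> n"
    then show "adomian \<alpha> lam mu k n t = 0" by (auto intro: adomian_eq_0)
  next
    assume "n = 0"
    have sums: "(\<lambda>l. q ^ (l + 1) * (real l ^ k - (real l + 1) ^ k) * c) sums (moment k (state_fps q 0) * c)"
      by (intro sums_mult2 moment_state_fps_0_sums q)
    then show "summable (\<lambda>l. q ^ (l + 1) * (real l ^ k - (real l + 1) ^ k) * c)"
      by (rule sums_summable)
    show "adomian \<alpha> lam mu k n t = (-1) ^ k * (lam - mu) ^ k *
        (\<Sum>l. q ^ (l + 1) * (real l ^ k - (real l + 1) ^ k) * c)"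
      using sums_unique[OF sums] adomian \<open>n = 0\<close> by simp
  next
    assume "1 \<le> n"
    have sums: "(\<lambda>l. q ^ l * real ((n + l) choose l)
        * (\<Sum>r = 0..n - 1. (-1) ^ r * real ((n - 1) choose r) * (real r + real l + 1) ^ k) * c)
        sums (moment k (state_fps q n) / (1 - q)\<^sup>2 * c)"
      by (intro sums_mult2 moment_state_fps_pos_sums q \<open>1 \<le> n\<close>)
    then show "summable (\<lambda>l. q ^ l * real ((n + l) choose l)
        * (\<Sum>r = 0..n - 1. (-1) ^ r * real ((n - 1) choose r) * (real r + real l + 1) ^ k) * c)"
      by (rule sums_summable)
    show "adomian \<alpha> lam mu k n t = (-1) ^ k * ((lam - mu) ^ (k + 2) / lam\<^sup>2) *
        (\<Sum>l. q ^ l * real ((n + l) choose l)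
        * (\<Sum>r = 0..n - 1. (-1) ^ r * real ((n - 1) choose r) * (real r + real l + 1) ^ k) * c)"
      unfolding sums_unique[OF sums, symmetric] adomian coeff by simp
  qed
qed

end
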